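(* Let $S_0=\emptyset$ and $S_k=\{1,2,\ldots,k\}$ for positive integers $k$. For $k\ge 0$, and $n\ge k+3$ or $n=k+1$, $$r_o^{S_k}(n) > r_e^{S_k}(n)\ \text{ if } k \text{ is even},\qquad r_e^{S_k}(n) > r_o^{S_k}(n)\ \text{ if } k \text{ is odd}.$$ Specifically, for these $n$ (that is, for $n\ge k+3$ or $n=k+1$) we have $r_o^{S_k}(n)-r_e^{S_k}(n)=\pm r^{S_k}(n,0)$. For all other $n$ we have equality, $r_o^{S_k}(n)=r_e^{S_k}(n)$.
   Context: Here $k$ and $n$ are integers. A partition is a finite, nonincreasing sequence of positive integers called its parts. The perimeter of a partition $\pi$ is $\alpha_\pi+\lambda_\pi-1$, where $\alpha_\pi$ is the largest part of $\pi$ and $\lambda_\pi$ is the number of parts of $\pi$ (counted with multiplicity). For a partition $\pi$, let $o(\pi)$ and $e(\pi)$ be the numbers of odd and even parts of $\pi$ (counted with multiplicity), and let $\omega(\pi)=o(\pi)-e(\pi)$. For a set $S$ of positive integers: $r_o^S(n)$ is the number of partitions of perimeter $n$ with more odd than even parts and no parts from $S$; $r_e^S(n)$ is the number of partitions of perimeter $n$ with more even than odd parts and no parts from $S$; and $r^S(n,m)$ is the number of partitions $\pi$ of perimeter $n$ with $\omega(\pi)=m$ and no parts from $S$.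
   Formalization: The identity r_o − r_e = ± r(n,0) is stated only for n ≥ k+3 (with sign (−1)^k), not for n = k+1, where it is false: the only partition of perimeter k+1 without parts from S_k is (k+1), so r(k+1,0) = 0 but the difference is ±1. *)

theory Defs
  imports Main
begin

definition is_partition :: "nat list \<Rightarrow> bool" where
  "is_partition \<pi> \<longleftrightarrow> sorted_wrt (\<ge>) \<pi> \<and> (\<forall>p\<in>set \<pi>. 0 < p)"

(* Meaningful for nonempty lists only: the empty partition has no largest part. *)
definition perimeter :: "nat list \<Rightarrow> int" where
  "perimeter \<pi> = int (Max (set \<pi>)) + int (length \<pi>) - 1"

definition odd_parts :: "nat list \<Rightarrow> nat" where
  "odd_parts \<pi> = length (filter odd \<pi>)"

definition even_parts :: "nat list \<Rightarrow> nat" where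
  "even_parts \<pi> = length (filter even \<pi>)"

definition omega :: "nat list \<Rightarrow> int" where
  "omega \<pi> = int (odd_parts \<pi>) - int (even_parts \<pi>)"

(* The partitions of perimeter n with no parts from S. *)
definition perimeter_partitions :: "nat set \<Rightarrow> int \<Rightarrow> nat list set" where
  "perimeter_partitions S n =
     {\<pi>. is_partition \<pi> \<and> \<pi> \<noteq> [] \<and> perimeter \<pi> = n \<and> set \<pi> \<inter> S = {}}"

definition r_o :: "nat set \<Rightarrow> int \<Rightarrow> nat" where
  "r_o S n = card {\<pi> \<in> perimeter_partitions S n. odd_parts \<pi> > even_parts \<pi>}"

definition r_e :: "nat set \<Rightarrow> int \<Rightarrow> nat" where
  "r_e S n = card {\<pi> \<in> perimeter_partitions S n. even_parts \<pi> > odd_parts \<pi>}"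

definition r :: "nat set \<Rightarrow> int \<Rightarrow> int \<Rightarrow> nat" where
  "r S n m = card {\<pi> \<in> perimeter_partitions S n. omega \<pi> = m}"

definition S_upto :: "nat \<Rightarrow> nat set" where
  "S_upto k = {1..k}"

(* The cardinalities above are therefore cardinalities of finite sets. *)
lemma finite_perimeter_partitions: "finite (perimeter_partitions S n)"
proof (rule finite_subset)
  show "perimeter_partitions S n \<subseteq> {\<pi>. set \<pi> \<subseteq> {..nat n} \<and> length \<pi> \<le> nat n}"
  proof
    fix \<pi> assume *: "\<pi> \<in> perimeter_partitions S n"
    have ne: "\<pi> \<noteq> []" and pos: "\<forall>p\<in>set \<pi>. 0 < p"
      and per: "int (Max (set \<pi>)) + int (length \<pi>) - 1 = n"
      using * by (auto simp: perimeter_partitions_def is_partition_def perimeter_def)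
    have "Max (set \<pi>) > 0" using ne pos by simp
    moreover have "length \<pi> > 0" using ne by simp
    ultimately have M: "Max (set \<pi>) \<le> nat n" and L: "length \<pi> \<le> nat n"
      using per by linarith+
    have "\<forall>p\<in>set \<pi>. p \<le> nat n"
      using M by (meson List.finite_set Max_ge le_trans)
    then show "\<pi> \<in> {\<pi>. set \<pi> \<subseteq> {..nat n} \<and> length \<pi> \<le> nat n}"
      using L by auto
  qed
  show "finite {\<pi>. set \<pi> \<subseteq> {..nat n} \<and> length \<pi> \<le> nat n}"
    by (rule finite_lists_length_le) simp
qed

end

theory Submission
  imports Defs
begin

text \<open>
  Let all parts exceed \<open>k\<close>. Lowering every part by one and then adjoining a new smallest part
  \<open>k + 1\<close> keeps the perimeter: the largest part drops by one and the number of parts grows by one.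
  It is possible exactly when \<open>k + 1\<close> is not a part, and its inverse (remove one copy of \<open>k + 1\<close>,
  raise the remaining parts by one) is possible exactly when \<open>k + 1\<close> is a part and not the only
  one. The sole partition on which neither makes sense is \<open>[k + 1]\<close>, of perimeter \<open>k + 1\<close>. For every
  perimeter \<open>n \<noteq> k + 1\<close> the two moves therefore form an involution (lemma \<open>exchange\<close>).

  Raising or lowering all parts by one negates \<open>\<omega>\<close>, and the part \<open>k + 1\<close> counts
  \<open>(-1)\<^sup>k\<close>, so the involution acts on \<open>\<omega>\<close> as the reflection \<open>m \<mapsto> (-1)\<^sup>k - m\<close>. For even \<open>k\<close> it
  exchanges \<open>\<omega> > 0\<close> with \<open>\<omega> \<le> 0\<close>, for odd \<open>k\<close> it exchanges \<open>\<omega> < 0\<close> with \<open>\<omega> \<ge> 0\<close>. In both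
  cases the odd and even counts differ by \<open>(-1)\<^sup>k\<close> times the number of partitions with
  \<open>\<omega> = 0\<close> (lemma \<open>r_o_minus_r_e\<close>).

  It remains to see when partitions with \<open>\<omega> = 0\<close> exist. They have at least two parts, of different
  parity, so the largest part is at least \<open>k + 2\<close> and the perimeter at least \<open>k + 3\<close>; conversely
  \<open>[n - 1, n - 2]\<close> is such a partition for every \<open>n \<ge> k + 3\<close> (lemma \<open>r_zero_pos_iff\<close>).
\<close>

lemma omega_Nil [simp]: "omega [] = 0"
  by (simp add: omega_def odd_parts_def even_parts_def)

lemma omega_Cons [simp]: "omega (p # \<pi>) = (-1) ^ Suc p + omega \<pi>"
  by (simp add: omega_def odd_parts_def even_parts_def)

lemma omega_append [simp]: "omega (\<pi> @ \<rho>) = omega \<pi> + omega \<rho>"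
  by (induction \<pi>) auto

lemma omega_map_Suc [simp]: "omega (map Suc \<pi>) = - omega \<pi>"
  by (induction \<pi>) auto

lemma omega_sign_iff:
  "even_parts \<pi> < odd_parts \<pi> \<longleftrightarrow> omega \<pi> > 0"
  "odd_parts \<pi> < even_parts \<pi> \<longleftrightarrow> omega \<pi> < 0"
  by (auto simp: omega_def)

lemma mem_perimeter_partitions_iff:
  "\<pi> \<in> perimeter_partitions (S_upto k) n \<longleftrightarrow>
     sorted_wrt (\<ge>) \<pi> \<and> \<pi> \<noteq> [] \<and> (\<forall>p\<in>set \<pi>. k < p) \<and> int (hd \<pi>) + int (length \<pi>) = n + 1"
proof (cases "is_partition \<pi> \<and> \<pi> \<noteq> []")
  case True
  then obtain p \<rho> where \<pi>: "\<pi> = p # \<rho>" by (cases \<pi>) auto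
  have "Max (set \<pi>) = hd \<pi>"
    using True unfolding \<pi> is_partition_def by (intro Max_eqI) auto
  then have "perimeter \<pi> = n \<longleftrightarrow> int (hd \<pi>) + int (length \<pi>) = n + 1"
    by (auto simp: perimeter_def)
  moreover have "set \<pi> \<inter> S_upto k = {} \<longleftrightarrow> (\<forall>p\<in>set \<pi>. k < p)"
    using True by (force simp: S_upto_def is_partition_def not_less Suc_le_eq)
  ultimately show ?thesis
    using True by (auto simp: perimeter_partitions_def is_partition_def)
next
  case False
  then show ?thesis
    by (auto simp: perimeter_partitions_def is_partition_def)
qed

definition exchange :: "nat \<Rightarrow> nat list \<Rightarrow> nat list" where
  "exchange k \<pi> = (if last \<pi> = Suc k then map Suc (butlast \<pi>)
                    else map (\<lambda>p. p - 1) \<pi> @ [Suc k])"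

lemma exchange_append [simp]: "exchange k (\<rho> @ [Suc k]) = map Suc \<rho>"
  by (simp add: exchange_def)

lemma exchange_map_Suc [simp]:
  assumes "\<rho> \<noteq> []" "\<forall>p\<in>set \<rho>. k < p"
  shows "exchange k (map Suc \<rho>) = \<rho> @ [Suc k]"
  using assms by (auto simp: exchange_def last_map o_def)

text \<open>
  A common remainder \<open>\<rho>\<close> of the two sides of the exchange: it makes both directions of the
  involution instances of the two preceding equations.
\<close>
lemma perimeter_partitions_cases:
  assumes "\<pi> \<in> perimeter_partitions (S_upto k) n" "n \<noteq> int k + 1"
  obtains \<rho> where "\<rho> \<noteq> []" "\<forall>p\<in>set \<rho>. k < p" "\<pi> = \<rho> @ [Suc k] \<or> \<pi> = map Suc \<rho>"
proof -
  have sorted: "sorted_wrt (\<ge>) \<pi>" and ne: "\<pi> \<noteq> []" and gt: "\<forall>p\<in>set \<pi>. k < p"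
    and size: "int (hd \<pi>) + int (length \<pi>) = n + 1"
    using assms(1) by (auto simp: mem_perimeter_partitions_iff)
  have \<pi>: "\<pi> = butlast \<pi> @ [last \<pi>]" using ne by simp
  show thesis
  proof (cases "last \<pi> = Suc k")
    case True
    \<comment> \<open>Otherwise \<open>\<pi> = [k + 1]\<close>, whose perimeter is the excluded one.\<close>
    have "butlast \<pi> \<noteq> []"
    proof
      assume "butlast \<pi> = []"
      then have "\<pi> = [Suc k]" using \<pi> True by simp
      then show False using size assms(2) by simp
    qed
    moreover have "\<forall>p\<in>set (butlast \<pi>). k < p" using gt by (auto dest: in_set_butlastD)
    ultimately show thesis using that[of "butlast \<pi>"] \<pi> True by metis
  next
    case False
    have "last \<pi> \<le> p" if "p \<in> set \<pi>" for p
    proof -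
      have "sorted_wrt (\<ge>) (butlast \<pi> @ [last \<pi>])" using sorted \<pi> by simp
      moreover have "p \<in> set (butlast \<pi> @ [last \<pi>])" using that \<pi> by simp
      ultimately show ?thesis by (auto simp: sorted_wrt_append)
    qed
    moreover have "Suc k < last \<pi>" using gt ne False by (simp add: Suc_lessI)
    ultimately have *: "\<forall>p\<in>set \<pi>. Suc k < p" by (meson le_trans not_less)
    have "map Suc (map (\<lambda>p. p - 1) \<pi>) = \<pi>"
      using * by (force intro: map_idI)
    then show thesis
      using that[of "map (\<lambda>p. p - 1) \<pi>"] ne * by fastforce
  qed
qed

lemma append_mem_iff_map_Suc_mem:
  assumes "\<rho> \<noteq> []" "\<forall>p\<in>set \<rho>. k < p"
  shows "\<rho> @ [Suc k] \<in> perimeter_partitions (S_upto k) n \<longleftrightarrow>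
         map Suc \<rho> \<in> perimeter_partitions (S_upto k) n"
  using assms
  by (auto simp: mem_perimeter_partitions_iff sorted_wrt_append sorted_wrt_map hd_map
      Suc_le_eq less_Suc_eq_le less_SucI)

lemma exchange:
  assumes "\<pi> \<in> perimeter_partitions (S_upto k) n" "n \<noteq> int k + 1"
  shows "exchange k \<pi> \<in> perimeter_partitions (S_upto k) n"
    and "exchange k (exchange k \<pi>) = \<pi>"
    and "omega (exchange k \<pi>) = (-1) ^ k - omega \<pi>"
proof -
  obtain \<rho> where \<rho>: "\<rho> \<noteq> []" "\<forall>p\<in>set \<rho>. k < p" "\<pi> = \<rho> @ [Suc k] \<or> \<pi> = map Suc \<rho>"
    using perimeter_partitions_cases[OF assms] by metis
  show "exchange k \<pi> \<in> perimeter_partitions (S_upto k) n"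
    using \<rho> assms(1) append_mem_iff_map_Suc_mem[OF \<rho>(1,2)] by auto
  show "exchange k (exchange k \<pi>) = \<pi>" "omega (exchange k \<pi>) = (-1) ^ k - omega \<pi>"
    using \<rho> by auto
qed

lemma card_omega_reflect:
  assumes "n \<noteq> int k + 1"
  shows "card {\<pi> \<in> perimeter_partitions (S_upto k) n. P (omega \<pi>)} =
         card {\<pi> \<in> perimeter_partitions (S_upto k) n. P ((-1) ^ k - omega \<pi>)}"
  by (rule bij_betw_same_card[of "exchange k"], rule bij_betw_byWitness[where f' = "exchange k"])
    (auto simp: exchange[OF _ assms])

lemma card_omega_nonpos:
  "card {\<pi> \<in> perimeter_partitions S n. omega \<pi> \<le> 0} = r_e S n + r S n 0"
  unfolding r_e_def r_def omega_sign_iff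
  by (subst card_Un_disjoint[symmetric])
    (auto simp: finite_perimeter_partitions intro!: arg_cong[where f = card])

lemma card_omega_nonneg:
  "card {\<pi> \<in> perimeter_partitions S n. omega \<pi> \<ge> 0} = r_o S n + r S n 0"
  unfolding r_o_def r_def omega_sign_iff
  by (subst card_Un_disjoint[symmetric])
    (auto simp: finite_perimeter_partitions intro!: arg_cong[where f = card])

lemma r_o_minus_r_e:
  assumes "n \<noteq> int k + 1"
  shows "int (r_o (S_upto k) n) - int (r_e (S_upto k) n) = (-1) ^ k * int (r (S_upto k) n 0)"
proof (cases "even k")
  case True
  have "r_o (S_upto k) n = card {\<pi> \<in> perimeter_partitions (S_upto k) n. 0 < 1 - omega \<pi>}"
    using card_omega_reflect[OF assms, of "\<lambda>m. 0 < m"] True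
    by (simp add: r_o_def omega_sign_iff)
  also have "\<dots> = card {\<pi> \<in> perimeter_partitions (S_upto k) n. omega \<pi> \<le> 0}"
    by (rule arg_cong[where f = card]) auto
  finally show ?thesis
    using True by (simp add: card_omega_nonpos)
next
  case False
  have "r_e (S_upto k) n = card {\<pi> \<in> perimeter_partitions (S_upto k) n. -1 - omega \<pi> < 0}"
    using card_omega_reflect[OF assms, of "\<lambda>m. m < 0"] False
    by (simp add: r_e_def omega_sign_iff)
  also have "\<dots> = card {\<pi> \<in> perimeter_partitions (S_upto k) n. omega \<pi> \<ge> 0}"
    by (rule arg_cong[where f = card]) auto
  finally show ?thesis
    using False by (simp add: card_omega_nonneg)
qed

lemma r_zero_pos_iff: "r (S_upto k) n 0 > 0 \<longleftrightarrow> n \<ge> int k + 3"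
proof
  assume "r (S_upto k) n 0 > 0"
  then have "{\<pi> \<in> perimeter_partitions (S_upto k) n. omega \<pi> = 0} \<noteq> {}"
    unfolding r_def by (metis card.empty less_irrefl)
  then obtain \<pi> where \<pi>: "\<pi> \<in> perimeter_partitions (S_upto k) n" "omega \<pi> = 0"
    by auto
  then have sorted: "sorted_wrt (\<ge>) \<pi>" and ne: "\<pi> \<noteq> []" and gt: "\<forall>p\<in>set \<pi>. k < p"
    and size: "int (hd \<pi>) + int (length \<pi>) = n + 1"
    by (auto simp: mem_perimeter_partitions_iff)
  \<comment> \<open>As \<open>\<omega> = 0\<close> and there is a part, both counts are positive.\<close>
  have "odd_parts \<pi> + even_parts \<pi> = length \<pi>"
    using sum_length_filter_compl[of odd \<pi>] by (simp add: odd_parts_def even_parts_def)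
  moreover have "odd_parts \<pi> = even_parts \<pi>" using \<pi>(2) by (simp add: omega_def)
  moreover have "length \<pi> > 0" using ne by simp
  ultimately have pos: "odd_parts \<pi> > 0" "even_parts \<pi> > 0" and len: "length \<pi> \<ge> 2"
    by presburger+
  obtain a where a: "a \<in> set \<pi>" "odd a"
    using pos(1) by (auto simp: odd_parts_def filter_empty_conv)
  obtain b where b: "b \<in> set \<pi>" "even b"
    using pos(2) by (auto simp: even_parts_def filter_empty_conv)
  have le_hd: "p \<le> hd \<pi>" if "p \<in> set \<pi>" for p
    using sorted that by (cases \<pi>) auto
  have "a \<noteq> b" using a b by auto
  moreover have "k < a" "k < b" using gt a(1) b(1) by auto
  ultimately have "hd \<pi> \<ge> k + 2"
    using le_hd[OF a(1)] le_hd[OF b(1)] by linarith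
  then show "n \<ge> int k + 3" using size len by linarith
next
  assume n: "n \<ge> int k + 3"
  define m where "m = nat (n - 2)"
  have m: "int m = n - 2" "k < m" using n by (auto simp: m_def)
  have "[Suc m, m] \<in> {\<pi> \<in> perimeter_partitions (S_upto k) n. omega \<pi> = 0}"
    using m by (auto simp: mem_perimeter_partitions_iff)
  then show "r (S_upto k) n 0 > 0"
    unfolding r_def by (subst card_gt_0_iff) (auto simp: finite_perimeter_partitions)
qed

lemma perimeter_partitions_least: "perimeter_partitions (S_upto k) (int k + 1) = {[Suc k]}"
proof -
  have "\<pi> = [Suc k]" if "\<pi> \<in> perimeter_partitions (S_upto k) (int k + 1)" for \<pi>
  proof -
    have "\<pi> \<noteq> []" "k < hd \<pi>" "int (hd \<pi>) + int (length \<pi>) = int k + 2"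
      using that by (auto simp: mem_perimeter_partitions_iff)
    then show ?thesis by (cases \<pi>) (auto simp flip: length_0_conv)
  qed
  then show ?thesis by (auto simp: mem_perimeter_partitions_iff)
qed

theorem theorem1p1:
  fixes k :: nat and n :: int
  shows "(n \<ge> int k + 3 \<or> n = int k + 1 \<longrightarrow>
            (even k \<longrightarrow> r_o (S_upto k) n > r_e (S_upto k) n) \<and>
            (odd k \<longrightarrow> r_e (S_upto k) n > r_o (S_upto k) n))
       \<and> (n \<ge> int k + 3 \<longrightarrow>
            int (r_o (S_upto k) n) - int (r_e (S_upto k) n) = (-1) ^ k * int (r (S_upto k) n 0))
       \<and> (\<not> (n \<ge> int k + 3 \<or> n = int k + 1) \<longrightarrow>
            r_o (S_upto k) n = r_e (S_upto k) n)"
proof (cases "n = int k + 1")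
  case True
  have "{\<pi> \<in> {[Suc k]}. P \<pi>} = (if P [Suc k] then {[Suc k]} else {})" for P
    by auto
  then show ?thesis
    using True by (simp add: r_o_def r_e_def perimeter_partitions_least omega_sign_iff)
next
  case False
  note diff = r_o_minus_r_e[OF False]
  show ?thesis
  proof (cases "n \<ge> int k + 3")
    case True
    then have "r (S_upto k) n 0 > 0" by (simp add: r_zero_pos_iff)
    then show ?thesis using diff True by (cases "even k") auto
  next
    case no: False
    then have "r (S_upto k) n 0 = 0" using r_zero_pos_iff[of k n] by simp
    then show ?thesis using diff no False by simp
  qed
qed

end
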